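(* Let $\{\alpha_n\}_{n\ge1},\{\beta_n\}_{n\ge1}\subset\mathbb C$ and let $p_n(z)=P_n^{(\alpha_n,\beta_n)}(z)$ (assumed to be of degree $n$). Suppose that (a) the limits $A=\lim_{n\to\infty}\alpha_n/n$ and $B=\lim_{n\to\infty}\beta_n/n$ exist and $1+A+B\neq 0$; (b) the sequence $\{\mu_n\}$ of root-counting measures of the $p_n$ converges weakly to a probability measure $\mu$ with compact support in $\mathbb C$. Then the Cauchy transform $\mathcal C_\mu$ satisfies, for Lebesgue-almost every $z\in\mathbb C$, the quadratic equation $$(1-z^2)\,\mathcal C_\mu(z)^2-\big((A+B)z+A-B\big)\,\mathcal C_\mu(z)+A+B+1=0.$$
   Context: For complex $\alpha,\beta$ and integer $n\ge0$, the Jacobi polynomial is $P_n^{(\alpha,\beta)}(z)=2^{-n}\sum_{k=0}^n\binom{n+\alpha}{n-k}\binom{n+\beta}{k}(z-1)^k(z+1)^{n-k}$, where $\binom{\gamma}{k}=\gamma(\gamma-1)\cdots(\gamma-k+1)/k!$. For a polynomial $p$ of degree $n$ with roots $\xi_1,\dots,\xi_n$ (with multiplicity), its root-counting measure is $\mu_p=\frac1n\sum_{i=1}^n\delta_{\xi_i}$. For a finite compactly supported Borel measure $\mu$ on $\mathbb C$, its Cauchy transform is $\mathcal C_\mu(z)=\int_{\mathbb C}\frac{d\mu(\xi)}{z-\xi}$ (defined almost everywhere). *)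

theory Defs
  imports "HOL-Probability.Probability" "HOL-Computational_Algebra.Computational_Algebra"
begin

definition jacobi_poly :: "nat \<Rightarrow> complex \<Rightarrow> complex \<Rightarrow> complex poly" where
  "jacobi_poly n a b =
     smult (1 / 2 ^ n)
       (\<Sum>k = 0..n. smult (((of_nat n + a) gchoose (n - k)) * ((of_nat n + b) gchoose k))
                         ([:-1, 1:] ^ k * [:1, 1:] ^ (n - k)))"

text \<open>Root-counting measure (1/deg p) * sum of Dirac masses at the roots, counted with
  multiplicity, as a Borel measure on the complex plane.\<close>
definition root_counting_measure :: "complex poly \<Rightarrow> complex measure" where
  "root_counting_measure p = distr (measure_pmf (pmf_of_multiset (proots p))) borel (\<lambda>x. x)"

definition weak_conv_cmeasure :: "(nat \<Rightarrow> complex measure) \<Rightarrow> complex measure \<Rightarrow> bool" where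
  "weak_conv_cmeasure \<mu>s \<mu> \<longleftrightarrow>
     (\<forall>f :: complex \<Rightarrow> real. continuous_on UNIV f \<and> bounded (range f) \<longrightarrow>
        (\<lambda>n. \<integral>x. f x \<partial>\<mu>s n) \<longlonglongrightarrow> (\<integral>x. f x \<partial>\<mu>))"

definition cauchy_transform :: "complex measure \<Rightarrow> complex \<Rightarrow> complex" where
  "cauchy_transform \<mu> z = (\<integral>\<xi>. 1 / (z - \<xi>) \<partial>\<mu>)"

end

(*
  Let w = p'/(n p) be the Cauchy transform of the root-counting measure of p = p_n. Dividing the
  Jacobi differential equation by n^2 p gives the Riccati equation
    (1 - z^2) (w^2 - S) + ((b - a - (a + b + 2) z) / n) w + (n + a + b + 1) / n = 0,
  where S = n^(-2) sum 1/(z - xi)^2 over the roots xi. Over a disc,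
  int |z - xi|^(-3/2) dz <= M uniformly in xi. As |S|^(3/4) is at most
  n^(-3/2) sum |z - xi|^(-3/2), its integral is O(n^(-1/2)), so S tends to 0 in measure, whatever
  the location of the roots. Truncating the Cauchy kernel at distance e changes every Cauchy
  transform of a probability measure by at most sqrt e * M in L^1, so weak convergence gives
  L^1-convergence of w to the Cauchy transform of mu. At almost every z both limits hold along a
  subsequence, and the Riccati equation passes to the limit.
*)
theory Submission
  imports Defs
begin

subsection \<open>The differential equation of the Jacobi polynomials\<close>

text \<open>Dividing by powers of \<open>z + c\<close> replaces the exponents \<open>k - 1\<close>
  and \<open>k - 2\<close>, so the formulas need no truncated subtraction and hold for k = 0 and k =
  1 as well.\<close>

lemma poly_pderiv_power_linear:
  fixes c z :: complex
  assumes "z + c \<noteq> 0"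
  shows "poly (pderiv ([:c, 1:] ^ k)) z = of_nat k * (z + c) ^ k / (z + c)"
    and "poly (pderiv (pderiv ([:c, 1:] ^ k))) z = of_nat k * (of_nat k - 1) * (z + c) ^ k / (z + c)\<^sup>2"
proof -
  define U where "U = [:c, 1:]"
  have U: "pderiv U = 1" "poly U z = z + c" by (simp_all add: U_def pderiv_pCons)
  have D: "pderiv (U ^ j) = smult (of_nat j) (U ^ (j - 1))" for j
    by (simp only: pderiv_power U mult_1_right)
  show "poly (pderiv ([:c, 1:] ^ k)) z = of_nat k * (z + c) ^ k / (z + c)"
    using assms unfolding U_def[symmetric] D by (cases k) (simp_all add: U)
  show "poly (pderiv (pderiv ([:c, 1:] ^ k))) z = of_nat k * (of_nat k - 1) * (z + c) ^ k / (z + c)\<^sup>2"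
  proof (cases k)
    case (Suc j)
    then show ?thesis
      using assms unfolding U_def[symmetric] D pderiv_smult
      by (cases j) (simp_all add: U power2_eq_square)
  qed simp
qed

text \<open>Multiplying \<open>t\<close> by (z + 1) / (z - 1) or by its inverse moves one factor
  between the two powers. The Jacobi operator therefore sends each term of the defining sum to a
  combination of itself and its two neighbours, which prepares the cancellation in
  \<open>jacobi_poly_ode\<close>.\<close>

lemma jacobi_operator_term:
  fixes a b z :: complex and k m :: nat
  assumes z: "z \<noteq> 1" "z \<noteq> -1"
  defines "t \<equiv> [:-1, 1:] ^ k * [:1, 1:] ^ m" and "n \<equiv> of_nat (k + m)"
  shows "(1 - z\<^sup>2) * poly (pderiv (pderiv t)) z + (b - a - (a + b + 2) * z) * poly (pderiv t) z
           + n * (n + a + b + 1) * poly t z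
       = (of_nat k * (of_nat k + a) * (1 - (z + 1) / (z - 1))
           + of_nat m * (of_nat m + b) * (1 - (z - 1) / (z + 1))) * poly t z"
proof -
  define u v where "u = z - 1" and "v = z + 1"
  have nz: "u \<noteq> 0" "v \<noteq> 0" using z by (auto simp: u_def v_def eq_neg_iff_add_eq_0)
  have uv: "poly [:-1, 1:] z = u" "poly [:1, 1:] z = v" "z + -1 = u" "z + 1 = v"
    by (simp_all add: u_def v_def)
  have nz': "z + -1 \<noteq> 0" "z + 1 \<noteq> 0" using nz unfolding uv by simp_all
  note D = poly_pderiv_power_linear[OF nz'(1), unfolded uv] poly_pderiv_power_linear[OF nz'(2), unfolded uv]
  have t0: "poly t z = u ^ k * v ^ m"
    by (simp only: t_def poly_mult poly_power uv)
  have t1: "poly (pderiv t) z = (of_nat k / u + of_nat m / v) * (u ^ k * v ^ m)"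
    unfolding t_def pderiv_mult poly_add poly_mult poly_power D uv
    by (simp add: algebra_simps)
  have t2: "poly (pderiv (pderiv t)) z = (of_nat k * (of_nat k - 1) / u\<^sup>2 + 2 * of_nat k * of_nat m / (u * v)
     + of_nat m * (of_nat m - 1) / v\<^sup>2) * (u ^ k * v ^ m)"
    unfolding t_def pderiv_mult pderiv_add poly_add poly_mult poly_power D uv
    by (simp add: algebra_simps)
  \<comment> \<open>With both coefficients written in \<open>u\<close> and \<open>v\<close>,
    dividing by u^k v^m leaves a rational identity in u / v and v / u, which is the next
    claim.\<close>
  have zz: "1 - z\<^sup>2 = - (u * v)" "b - a - (a + b + 2) * z = - (b + 1) * u - (a + 1) * v"
    by (simp_all add: u_def v_def algebra_simps power2_eq_square)
  have "- (u * v) * (of_nat k * (of_nat k - 1) / u\<^sup>2 + 2 * of_nat k * of_nat m / (u * v)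
     + of_nat m * (of_nat m - 1) / v\<^sup>2) + (- (b + 1) * u - (a + 1) * v) * (of_nat k / u + of_nat m / v)
     + n * (n + a + b + 1)
     = of_nat k * (of_nat k + a) * (1 - v / u) + of_nat m * (of_nat m + b) * (1 - u / v)"
    using nz unfolding n_def of_nat_add
    by (simp add: divide_simps power2_eq_square) (simp add: algebra_simps)
  then show ?thesis
    unfolding zz t0 t1 t2 u_def[symmetric] v_def[symmetric] by (metis (no_types, lifting) distrib_right mult.assoc)
qed

text \<open>The operator contributes H_k (T_k - T_(k-1)) + H'_k (T_k - T_(k+1)) for the k-th term.
  Since H_(k+1) = H'_k, the four resulting sums cancel in pairs after an index shift.\<close>

lemma jacobi_poly_ode:
  fixes a b z :: complex and n :: nat
  assumes z: "z \<noteq> 1" "z \<noteq> -1"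
  defines "p \<equiv> jacobi_poly n a b"
  shows "(1 - z\<^sup>2) * poly (pderiv (pderiv p)) z + (b - a - (a + b + 2) * z) * poly (pderiv p) z
           + of_nat n * (of_nat n + a + b + 1) * poly p z = 0"
proof -
  define u v where "u = z - 1" and "v = z + 1"
  have nz: "u \<noteq> 0" "v \<noteq> 0" using z by (auto simp: u_def v_def eq_neg_iff_add_eq_0)
  define c where "c k = ((of_nat n + a) gchoose (n - k)) * ((of_nat n + b) gchoose k)" for k
  define t where "t k = ([:-1, 1:] ^ k * [:1, 1:] ^ (n - k) :: complex poly)" for k
  define T where "T k = poly (t k) z" for k
  define L where "L q = (1 - z\<^sup>2) * poly (pderiv (pderiv q)) z + (b - a - (a + b + 2) * z) * poly (pderiv q) z
           + of_nat n * (of_nat n + a + b + 1) * poly q z" for q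
  have L_add: "L (q + r) = L q + L r" and L_smult: "L (smult d q) = d * L q" for q r d
    by (simp_all add: L_def pderiv_add pderiv_smult algebra_simps)
  have L_sum: "L (\<Sum>k\<in>S. f k) = (\<Sum>k\<in>S. L (f k))" if "finite S" for f and S :: "nat set"
    using that by induction (simp_all add: L_add, simp add: L_def)
  define H where "H k = c k * of_nat k * (of_nat k + a)" for k
  define H' where "H' k = c k * of_nat (n - k) * (of_nat (n - k) + b)" for k
  have T: "T k * u = T (Suc k) * v" if "k < n" for k
  proof -
    have "n - k = Suc (n - Suc k)" using that by simp
    moreover have "poly [:-1, 1:] z = u" "poly [:1, 1:] z = v" by (simp_all add: u_def v_def)
    ultimately show ?thesis
      by (simp only: T_def t_def poly_mult poly_power power_Suc mult_ac)
  qed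
  \<comment> \<open>Both sides reduce to (k + 1 + a) (j + 1 + b) times the binomials with lower
    indices j and k. This uses (i + 1) binom(x, i + 1) = (x - i) binom(x, i) once for x = n + a and
    once for x = n + b, with n = k + 1 + j.\<close>
  have HH: "H (Suc k) = H' k" if "k < n" for k
  proof -
    define j where "j = n - Suc k"
    have j: "n - k = Suc j" "n = Suc k + j" "n - Suc k = j" using that by (auto simp: j_def)
    have 1: "of_nat (Suc j) * ((of_nat n + a) gchoose Suc j) = (of_nat (Suc k) + a) * ((of_nat n + a) gchoose j)"
      using gbinomial_mult_1[of "of_nat n + a" j] unfolding j(2) of_nat_add by (simp add: algebra_simps)
    have 2: "of_nat (Suc k) * ((of_nat n + b) gchoose Suc k) = (of_nat (Suc j) + b) * ((of_nat n + b) gchoose k)"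
      using gbinomial_mult_1[of "of_nat n + b" k] unfolding j(2) of_nat_add by (simp add: algebra_simps)
    have "H (Suc k) = ((of_nat (Suc k) + a) * ((of_nat n + a) gchoose j)) * (of_nat (Suc k) * ((of_nat n + b) gchoose Suc k))"
      unfolding H_def c_def j(3) by (simp only: mult_ac)
    also have "\<dots> = H' k"
      unfolding H'_def c_def j(1) 1[symmetric] 2 by (simp only: mult_ac)
    finally show ?thesis .
  qed
  have LT: "c k * L (t k) = H k * T k - H k * (v / u) * T k + (H' k * T k - H' k * (u / v) * T k)"
    if "k \<le> n" for k
  proof -
    have eq: "of_nat (k + (n - k)) = (of_nat n :: complex)" using that by simp
    have Lt: "L (t k) = (of_nat k * (of_nat k + a) * (1 - v / u)
        + of_nat (n - k) * (of_nat (n - k) + b) * (1 - u / v)) * T k"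
      unfolding L_def t_def T_def u_def v_def
      by (rule jacobi_operator_term[OF z, where k = k and m = "n - k", unfolded eq])
    show ?thesis
      unfolding Lt H_def H'_def by (simp add: algebra_simps)
  qed
  \<comment> \<open>These zeros remove the boundary terms, that is, the neighbours T_(-1) and
    T_(n+1) that lie outside the sum.\<close>
  have H0: "H 0 = 0" "H' n = 0" by (simp_all add: H_def H'_def)
  have shift: "(\<Sum>k\<le>n. H k * x k) = (\<Sum>k<n. H' k * x (Suc k))" for x :: "nat \<Rightarrow> complex"
  proof -
    have "(\<Sum>k\<le>n. H k * x k) = (\<Sum>k<Suc n. H k * x k)" by (simp add: lessThan_Suc_atMost)
    also have "\<dots> = (\<Sum>k<n. H' k * x (Suc k))"
      by (subst sum.lessThan_Suc_shift) (simp add: H0 HH)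
    finally show ?thesis .
  qed
  have drop: "(\<Sum>k\<le>n. H' k * x k) = (\<Sum>k<n. H' k * x k)" for x :: "nat \<Rightarrow> complex"
    by (simp add: lessThan_Suc_atMost[symmetric] H0)
  have TS: "T k = T (Suc k) * (v / u)" "T (Suc k) = T k * (u / v)" if "k < n" for k
    using T[OF that] nz by (simp_all add: field_simps)
  have "(\<Sum>k\<le>n. c k * L (t k)) = (\<Sum>k\<le>n. H k * T k) - (\<Sum>k\<le>n. H k * ((v / u) * T k))
      + ((\<Sum>k\<le>n. H' k * T k) - (\<Sum>k\<le>n. H' k * ((u / v) * T k)))"
    by (simp add: LT sum.distrib sum_subtractf mult.assoc)
  also have "(\<Sum>k\<le>n. H k * T k) = (\<Sum>k\<le>n. H' k * ((u / v) * T k))"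
    unfolding shift drop by (intro sum.cong refl) (simp add: TS(2))
  also have "(\<Sum>k\<le>n. H k * ((v / u) * T k)) = (\<Sum>k\<le>n. H' k * T k)"
    unfolding shift drop by (intro sum.cong refl) (use TS(1) in \<open>simp add: mult.commute\<close>)
  finally have "(\<Sum>k\<le>n. c k * L (t k)) = 0" by simp
  moreover have "p = smult (1 / 2 ^ n) (\<Sum>k\<le>n. smult (c k) (t k))"
    by (simp add: p_def jacobi_poly_def c_def t_def atLeast0AtMost)
  ultimately have "L p = 0" by (simp add: L_smult L_sum)
  then show ?thesis by (simp add: L_def)
qed

section \<open>Sums over roots and root-counting measures\<close>

text \<open>The logarithmic derivative q'/q is the sum of 1 / (z - xi), and q''/q = (q'/q)^2 +
  (q'/q)', where differentiating the sum gives minus the sum of inverse squares. The proof adds one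
  root at a time by the product rule.\<close>

lemma poly_pderiv_prod_mset_linear:
  fixes A :: "complex multiset"
  defines "q \<equiv> (\<Prod>\<xi>\<in>#A. [:-\<xi>, 1:])"
  assumes "z \<notin># A"
  shows "poly q z \<noteq> 0"
    and "poly (pderiv q) z = (\<Sum>\<xi>\<in>#A. 1 / (z - \<xi>)) * poly q z"
    and "poly (pderiv (pderiv q)) z
           = ((\<Sum>\<xi>\<in>#A. 1 / (z - \<xi>))\<^sup>2 - (\<Sum>\<xi>\<in>#A. 1 / (z - \<xi>)\<^sup>2)) * poly q z"
proof -
  have "poly q z \<noteq> 0 \<and> poly (pderiv q) z = (\<Sum>\<xi>\<in>#A. 1 / (z - \<xi>)) * poly q z \<and>
    poly (pderiv (pderiv q)) z = ((\<Sum>\<xi>\<in>#A. 1 / (z - \<xi>))\<^sup>2 - (\<Sum>\<xi>\<in>#A. 1 / (z - \<xi>)\<^sup>2)) * poly q z"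
    using assms(2) unfolding q_def
  proof (induction A)
    case (add x A)
    define w where "w = z - x"
    have "w \<noteq> 0" using add.prems by (auto simp: w_def)
    have lin: "pderiv [:-x, 1:] = 1" "poly [:-x, 1:] z = w"
      by (simp_all add: w_def pderiv_pCons)
    define q S S2 where "q = (\<Prod>\<xi>\<in>#A. [:-\<xi>, 1:])" and "S = (\<Sum>\<xi>\<in>#A. 1 / (z - \<xi>))"
      and "S2 = (\<Sum>\<xi>\<in>#A. 1 / (z - \<xi>)\<^sup>2)"
    have IH: "poly q z \<noteq> 0" "poly (pderiv q) z = S * poly q z" "poly (pderiv (pderiv q)) z = (S\<^sup>2 - S2) * poly q z"
      using add by (auto simp: q_def S_def S2_def)
    show ?case
      unfolding image_mset_add_mset prod_mset.add_mset sum_mset.add_mset q_def[symmetric]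
        S_def[symmetric] S2_def[symmetric] pderiv_mult lin poly_add poly_mult pderiv_add IH(2,3)
      using IH(1) \<open>w \<noteq> 0\<close>
      by (simp add: w_def[symmetric] IH(2) power2_eq_square field_simps)
  qed simp
  then show "poly q z \<noteq> 0" "poly (pderiv q) z = (\<Sum>\<xi>\<in>#A. 1 / (z - \<xi>)) * poly q z"
    "poly (pderiv (pderiv q)) z = ((\<Sum>\<xi>\<in>#A. 1 / (z - \<xi>))\<^sup>2 - (\<Sum>\<xi>\<in>#A. 1 / (z - \<xi>)\<^sup>2)) * poly q z"
    by auto
qed

lemma sum_mset_image_eq_sum_count:
  fixes f :: "'a \<Rightarrow> 'b :: comm_semiring_1"
  shows "(\<Sum>x\<in>#A. f x) = (\<Sum>x\<in>set_mset A. of_nat (count A x) * f x)"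
proof -
  \<comment> \<open>A fixed finite superset \<open>S\<close> of the support keeps the index set
    constant while the induction enlarges the multiset.\<close>
  have "(\<Sum>x\<in>#A. f x) = (\<Sum>x\<in>S. of_nat (count A x) * f x)" if "finite S" "set_mset A \<subseteq> S" for S
    using that
  proof (induction A)
    case (add y A)
    have "(\<Sum>x\<in>S. of_nat (count (add_mset y A) x) * f x)
        = (\<Sum>x\<in>S. (if x = y then f x else 0) + of_nat (count A x) * f x)"
      by (intro sum.cong) (auto simp: algebra_simps)
    with add show ?case by (simp add: sum.distrib)
  qed simp
  then show ?thesis by simp
qed

text \<open>Degree at least 1 makes the multiset of roots nonempty, so that
  \<open>pmf_of_multiset\<close> has its intended meaning. The integral is a finite sum, so
  unbounded functions such as the Cauchy kernel are covered.\<close>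

lemma
  fixes f :: "complex \<Rightarrow> complex"
  assumes p: "degree p \<ge> 1"
  shows integral_root_counting_measure: "f \<in> borel_measurable borel \<Longrightarrow>
      (\<integral>x. f x \<partial>root_counting_measure p) = (\<Sum>\<xi>\<in>#proots p. f \<xi>) / of_nat (degree p)"
    and prob_space_root_counting_measure: "prob_space (root_counting_measure p)"
proof -
  have ne: "proots p \<noteq> {#}" using size_proots_complex[of p] p by auto
  show "prob_space (root_counting_measure p)"
    unfolding root_counting_measure_def
    by (intro prob_space.prob_space_distr measure_pmf.prob_space_axioms) simp
  assume [measurable]: "f \<in> borel_measurable borel"
  have "(\<integral>x. f x \<partial>root_counting_measure p) = (\<integral>x. f x \<partial>measure_pmf (pmf_of_multiset (proots p)))"
    unfolding root_counting_measure_def by (subst integral_distr) simp_all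
  also have "\<dots> = (\<Sum>\<xi>\<in>set_mset (proots p). pmf (pmf_of_multiset (proots p)) \<xi> *\<^sub>R f \<xi>)"
    by (rule integral_measure_pmf) (use ne in \<open>auto simp: set_pmf_of_multiset\<close>)
  also have "\<dots> = (\<Sum>\<xi>\<in>set_mset (proots p). of_nat (count (proots p) \<xi>) * f \<xi>) / of_nat (degree p)"
    unfolding sum_divide_distrib pmf_of_multiset[OF ne] size_proots_complex
    by (simp add: scaleR_conv_of_real of_real_divide)
  also have "(\<Sum>\<xi>\<in>set_mset (proots p). of_nat (count (proots p) \<xi>) * f \<xi>) = (\<Sum>\<xi>\<in>#proots p. f \<xi>)"
    by (rule sum_mset_image_eq_sum_count[symmetric])
  finally show "(\<integral>x. f x \<partial>root_counting_measure p) = (\<Sum>\<xi>\<in>#proots p. f \<xi>) / of_nat (degree p)" .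
qed

subsection \<open>Convergence of Cauchy transforms\<close>

text \<open>With s = x + y, the ratio t / s lies in [0, 1], hence t / s is at most (t / s)^p.
  Multiplying by s^p and adding the cases t = x and t = y gives the claim.\<close>

lemma powr_add_le_add_powr:
  fixes x y p :: real
  assumes "0 \<le> x" "0 \<le> y" "0 \<le> p" "p \<le> 1"
  shows "(x + y) powr p \<le> x powr p + y powr p"
proof (cases "x + y = 0")
  case False
  define s where "s = x + y"
  have s: "s > 0" using False assms by (simp add: s_def)
  have *: "t / s * s powr p \<le> t powr p" if "0 \<le> t" "t \<le> s" for t
  proof -
    have "(t / s) powr 1 \<le> (t / s) powr p"
      using that s assms by (intro powr_mono') auto
    then have "t / s * s powr p \<le> (t / s) powr p * s powr p"
      using that s by (intro mult_right_mono) auto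
    also have "\<dots> = t powr p" using that s by (simp add: powr_mult[symmetric])
    finally show ?thesis .
  qed
  have "s powr p = x / s * s powr p + y / s * s powr p"
    using s by (simp add: s_def add_divide_distrib[symmetric] distrib_right[symmetric])
  then show ?thesis
    using *[of x] *[of y] assms by (simp add: s_def)
qed (use assms in simp)

text \<open>Used with p = 3/4 on the sum of inverse squares: |z|^(-2) is not locally integrable in
  the plane, but its power |z|^(-3/2) is.\<close>

lemma norm_sum_mset_powr_le:
  fixes f :: "'a \<Rightarrow> 'b :: real_normed_vector"
  assumes "0 \<le> p" "p \<le> 1"
  shows "norm (\<Sum>x\<in>#A. f x) powr p \<le> (\<Sum>x\<in>#A. norm (f x) powr p)"
proof (induction A)
  case (add y A)
  have "norm (\<Sum>x\<in>#add_mset y A. f x) powr p \<le> (norm (f y) + norm (\<Sum>x\<in>#A. f x)) powr p"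
    using assms by (auto intro!: powr_mono2 norm_triangle_ineq)
  also have "\<dots> \<le> norm (f y) powr p + norm (\<Sum>x\<in>#A. f x) powr p"
    using assms by (intro powr_add_le_add_powr) auto
  finally show ?case using add by simp
qed (use assms in simp)

section \<open>Riesz potentials of exponent 3/2 over discs\<close>

text \<open>On the annulus 4^(-k-1) <= |z| < 4^(-k) the integrand is at most 8^(k+1), while the disc
  of radius 4^(-k) has area proportional to 16^(-k). Summing over k gives a geometric series of
  ratio 1/2. The ratio 4 of the radii makes the power 3/2 an integer.\<close>

lemma nn_integral_powr_unit_disc_finite:
  "(\<integral>\<^sup>+z. ennreal (norm z powr (-3/2)) * indicator (ball (0::complex) 1) z \<partial>lborel) < \<infinity>"
proof -
  define g where "g k z = ennreal (8 ^ Suc k) * indicator (ball (0::complex) ((1/4) ^ k)) z" for k z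
  have le: "ennreal (norm z powr (-3/2)) * indicator (ball 0 1) z \<le> (\<Sum>k. g k z)" for z
  \<comment> \<open>The value at the pole is 0, since \<open>0 powr (-3/2) = 0\<close>.\<close>
  proof (cases "z = 0 \<or> norm z \<ge> 1")
    case False
    then have z: "z \<noteq> 0" "norm z < 1" by auto
    define j where "j = (LEAST j. (1/4) ^ j \<le> norm z)"
    have "\<exists>j. (1/4) ^ j < norm z" using z by (intro real_arch_pow_inv) auto
    then have ex: "\<exists>j. (1/4) ^ j \<le> norm z" by (auto intro: less_imp_le)
    then have j: "(1/4) ^ j \<le> norm z" unfolding j_def by (rule LeastI_ex)
    have "j \<noteq> 0" using j z by (intro notI) simp
    then obtain k where k: "j = Suc k" by (cases j) auto
    have "\<not> (1/4) ^ k \<le> norm z"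
      unfolding j_def using not_less_Least[of k "\<lambda>j. (1/4) ^ j \<le> norm z"] k by (simp add: j_def)
    then have mem: "z \<in> ball 0 ((1/4) ^ k)" by simp
    have "norm z powr (-3/2) \<le> ((1/4) ^ j) powr (-3/2)"
      using j by (intro powr_mono2') auto
    also have "((1/4) ^ j :: real) = 2 powr (- 2 * real j)"
    proof -
      have "(2::real) powr (- 2 * real j) = (2 powr (-2)) powr real j" by (simp only: powr_powr)
      also have "(2::real) powr (-2) = 1/4" by (simp add: powr_minus powr_numeral)
      finally show ?thesis by (simp add: powr_realpow)
    qed
    also have "\<dots> powr (-3/2) = 2 powr (3 * real j)" by (simp add: powr_powr)
    also have "\<dots> = (2 powr 3) powr real j" by (simp only: powr_powr)
    also have "\<dots> = 8 ^ j" by (simp add: powr_realpow powr_numeral)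
    finally have "ennreal (norm z powr (-3/2)) * indicator (ball 0 1) z \<le> g k z"
      using mem z unfolding g_def k[symmetric] by (simp add: ennreal_leI)
    also have "\<dots> \<le> (\<Sum>k. g k z)"
      using sum_le_suminf[of "\<lambda>k. g k z" "{k}"] by simp
    finally show ?thesis .
  qed auto
  have int_g: "(\<integral>\<^sup>+z. g k z \<partial>lborel) = ennreal (8 * unit_ball_vol 2 * (1/2) ^ k)" for k
  proof -
    have "(\<integral>\<^sup>+z. g k z \<partial>lborel) = ennreal (8 ^ Suc k) * ennreal (unit_ball_vol 2 * ((1/4) ^ k) ^ 2)"
      unfolding g_def by (subst nn_integral_cmult_indicator) (auto simp: emeasure_ball)
    also have "\<dots> = ennreal (8 ^ Suc k * (unit_ball_vol 2 * ((1/4) ^ k) ^ 2))"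
      by (rule ennreal_mult[symmetric]) auto
    also have "8 ^ Suc k * (unit_ball_vol 2 * ((1/4) ^ k) ^ 2)
        = 8 * unit_ball_vol 2 * (8 ^ k * (1/4) ^ k * (1/4) ^ k)"
      by (simp add: power2_eq_square)
    also have "8 ^ k * (1/4) ^ k * (1/4) ^ k = (8 * (1/4) * (1/4) :: real) ^ k"
      by (simp only: power_mult_distrib)
    finally show ?thesis by simp
  qed
  have "(\<integral>\<^sup>+z. ennreal (norm z powr (-3/2)) * indicator (ball (0::complex) 1) z \<partial>lborel)
      \<le> (\<integral>\<^sup>+z. (\<Sum>k. g k z) \<partial>lborel)"
    by (intro nn_integral_mono le)
  also have "\<dots> = (\<Sum>k. \<integral>\<^sup>+z. g k z \<partial>lborel)"
    unfolding g_def
    by (intro nn_integral_suminf borel_measurable_times_ennreal borel_measurable_indicator) auto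
  also have "\<dots> = (\<Sum>k. ennreal (8 * unit_ball_vol 2 * (1/2) ^ k))"
    by (simp only: int_g)
  also have "\<dots> < \<infinity>"
    by (subst suminf_ennreal2) (auto intro!: summable_mult summable_geometric)
  finally show ?thesis .
qed

text \<open>A density instead of a restriction keeps the whole plane as the space and the Borel sets
  as the measurable sets, as the locale below requires.\<close>

definition disc_measure :: "real \<Rightarrow> complex measure" where
  "disc_measure R = density lborel (indicator (ball 0 R))"

lemma AE_disc_measure_iff: "(AE z in disc_measure R. P z) \<longleftrightarrow> (AE z in lborel. z \<in> ball 0 R \<longrightarrow> P z)"
proof -
  have "(indicator (ball 0 R) :: complex \<Rightarrow> ennreal) \<in> borel_measurable lborel"
    by (intro borel_measurable_indicator) auto
  then have "(AE z in disc_measure R. P z) \<longleftrightarrow> (AE z in lborel. 0 < (indicator (ball 0 R) z :: ennreal) \<longrightarrow> P z)"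
    unfolding disc_measure_def by (rule AE_density)
  also have "(\<lambda>z. 0 < (indicator (ball 0 R) z :: ennreal) \<longrightarrow> P z) = (\<lambda>z. z \<in> ball 0 R \<longrightarrow> P z)"
    by (auto simp: indicator_def)
  finally show ?thesis .
qed

text \<open>These properties of the disc carry all the L^1 estimates. The exponent 3/2 is larger
  than 1, so it controls the Cauchy kernel with room to spare, and smaller than 2, so it is locally
  integrable. The bound \<open>M\<close> is uniform in the pole.\<close>

locale bounded_riesz_potential = finite_measure N for N :: "complex measure" +
  fixes M :: real
  assumes sets_N [measurable_cong]: "sets N = sets borel"
    and M_nonneg: "0 \<le> M"
    and riesz_le: "(\<integral>\<^sup>+z. ennreal (norm (z - \<xi>) powr (-3/2)) \<partial>N) \<le> ennreal M"

text \<open>Where |z - xi| < 1 the kernel is a translate of the unit disc integrand, which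
  contributes at most \<open>c\<close> by translation invariance. Elsewhere it is at most 1 and
  contributes at most the area of the disc. Neither bound depends on xi.\<close>

lemma bounded_riesz_potential_disc_measure: "\<exists>M. bounded_riesz_potential (disc_measure R) M"
proof -
  define g where "g z = ennreal (norm z powr (-3/2)) * indicator (ball (0::complex) 1) z" for z
  have [measurable]: "g \<in> borel_measurable borel"
    unfolding g_def by (intro borel_measurable_times_ennreal borel_measurable_indicator) auto
  define c where "c = (\<integral>\<^sup>+z. g z \<partial>lborel)"
  define M where "M = enn2real (c + emeasure lborel (ball (0::complex) R))"
  have fin: "emeasure lborel (ball (0::complex) R) < \<infinity>"
    using emeasure_lborel_ball_finite[of "0::complex" R] by (simp add: less_top)
  have M: "ennreal M = c + emeasure lborel (ball (0::complex) R)"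
    unfolding M_def using fin nn_integral_powr_unit_disc_finite by (simp add: c_def g_def less_top)
  have [measurable]: "(indicator (ball 0 R) :: complex \<Rightarrow> ennreal) \<in> borel_measurable borel"
    by (intro borel_measurable_indicator borel_open open_ball)
  interpret finite_measure "disc_measure R"
  proof
    have "emeasure (disc_measure R) UNIV = emeasure lborel (ball (0::complex) R)"
      unfolding disc_measure_def by (subst emeasure_density) auto
    with fin show "emeasure (disc_measure R) (space (disc_measure R)) \<noteq> \<infinity>"
      by (simp add: disc_measure_def)
  qed
  have "(\<integral>\<^sup>+z. ennreal (norm (z - \<xi>) powr (-3/2)) \<partial>disc_measure R) \<le> ennreal M" for \<xi>
  proof -
    have "(\<integral>\<^sup>+z. ennreal (norm (z - \<xi>) powr (-3/2)) \<partial>disc_measure R)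
        = (\<integral>\<^sup>+z. indicator (ball 0 R) z * ennreal (norm (z - \<xi>) powr (-3/2)) \<partial>lborel)"
      unfolding disc_measure_def by (subst nn_integral_density) auto
    also have "\<dots> \<le> (\<integral>\<^sup>+z. g (- \<xi> + z)
                  + indicator (ball 0 R) z \<partial>lborel)"
    proof (rule nn_integral_mono)
      fix z :: complex
      show "indicator (ball 0 R) z * ennreal (norm (z - \<xi>) powr (-3/2))
        \<le> g (- \<xi> + z) + indicator (ball 0 R) z"
      proof (cases "norm (z - \<xi>) < 1")
        case False
        then have "norm (z - \<xi>) powr (-3/2) \<le> 1 powr (-3/2)" by (intro powr_mono2') auto
        then have "ennreal (norm (z - \<xi>) powr (-3/2)) \<le> 1" by (simp add: ennreal_le_1)
        with False show ?thesis by (simp add: g_def indicator_def)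
      qed (simp add: g_def indicator_def)
    qed
    also have "\<dots> = (\<integral>\<^sup>+z. g (- \<xi> + z) \<partial>lborel)
        + emeasure lborel (ball (0::complex) R)"
      by (subst nn_integral_add) auto
    also have "(\<integral>\<^sup>+z. g (- \<xi> + z) \<partial>lborel)
        = (\<integral>\<^sup>+z. g z \<partial>distr lborel borel ((+) (- \<xi>)))"
      by (subst nn_integral_distr) auto
    also have "\<dots> = c" by (simp only: lborel_distr_plus c_def)
    finally show ?thesis by (simp only: M)
  qed
  then have "bounded_riesz_potential (disc_measure R) M"
    by unfold_locales (auto simp: disc_measure_def M_def)
  then show ?thesis ..
qed

section \<open>The truncated Cauchy kernel\<close>

text \<open>Since 1 / w = cnj w / |w|^2, this agrees with the Cauchy kernel for |w| >= e and is cnj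
  w / e^2 inside. For e > 0 it is a bounded continuous function, hence admissible for weak
  convergence.\<close>

definition truncated_kernel :: "real \<Rightarrow> complex \<Rightarrow> complex" where
  "truncated_kernel e w = cnj w / of_real (max ((norm w)\<^sup>2) (e\<^sup>2))"

lemma continuous_truncated_kernel:
  assumes "e > 0"
  shows "continuous_on UNIV (truncated_kernel e)"
proof -
  have "max ((norm w)\<^sup>2) (e\<^sup>2) \<noteq> 0" for w :: complex
    using assms by (metis max.cobounded2 not_less power2_less_eq_zero_iff zero_less_power less_irrefl order.strict_trans2)
  then show ?thesis
    unfolding truncated_kernel_def by (intro continuous_intros) auto
qed

lemma norm_truncated_kernel: "norm (truncated_kernel e w) = norm w / max ((norm w)\<^sup>2) (e\<^sup>2)"
  unfolding truncated_kernel_def norm_divide norm_of_real by (simp add: abs_of_nonneg le_max_iff_disj)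

lemma norm_truncated_kernel_le:
  assumes e: "e > 0"
  shows "norm (truncated_kernel e w) \<le> 1 / e"
proof (cases "norm w \<ge> e")
  case True
  then have "max ((norm w)\<^sup>2) (e\<^sup>2) = (norm w)\<^sup>2" using e by (intro max_absorb1 power_mono) auto
  with True e show ?thesis
    by (simp add: norm_truncated_kernel) (auto simp: power2_eq_square frac_le)
next
  case False
  then have "max ((norm w)\<^sup>2) (e\<^sup>2) = e\<^sup>2" by (intro max_absorb2 power_mono) auto
  with False e show ?thesis
    by (simp add: norm_truncated_kernel) (auto simp: power2_eq_square field_simps)
qed

text \<open>The difference vanishes for |w| >= e. For 0 < r = |w| < e it is at most 1 / r = r^(1/2)
  r^(-3/2), where r^(1/2) is at most sqrt e. For w = 0 both sides are 0 because
  \<open>1 / 0 = 0\<close>.\<close>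

lemma norm_diff_truncated_kernel_le:
  assumes e: "e > 0"
  shows "norm (1 / w - truncated_kernel e w) \<le> sqrt e * norm w powr (-3/2)"
proof (cases "norm w \<ge> e")
  case True
  then have "max ((norm w)\<^sup>2) (e\<^sup>2) = (norm w)\<^sup>2" using e by (intro max_absorb1 power_mono) auto
  then have "1 / w = truncated_kernel e w"
    by (simp add: truncated_kernel_def complex_div_cnj[of 1 w])
  then show ?thesis using e by simp
next
  case False
  then have m: "max ((norm w)\<^sup>2) (e\<^sup>2) = e\<^sup>2" by (intro max_absorb2 power_mono) auto
  show ?thesis
  proof (cases "w = 0")
    case w: False
    define r where "r = norm w"
    have r: "0 < r" "r < e" using w False by (auto simp: r_def)
    have "1 / w - truncated_kernel e w = 1 / w * of_real (1 - r\<^sup>2 / e\<^sup>2)"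
      using w e unfolding truncated_kernel_def m complex_div_cnj[of 1 w] r_def
      by (simp add: field_simps)
    then have "norm (1 / w - truncated_kernel e w) = 1 / r * \<bar>1 - r\<^sup>2 / e\<^sup>2\<bar>"
      by (simp only: norm_mult norm_divide norm_of_real norm_one r_def)
    also have "\<dots> \<le> 1 / r * 1"
      using r by (intro mult_left_mono) (auto simp: power_mono abs_le_iff intro!: order_trans[OF divide_nonneg_nonneg])
    also have "1 / r * 1 = r powr (1/2 + -3/2)"
      using r by (simp add: powr_minus_divide)
    also have "\<dots> = sqrt r * r powr (-3/2)"
      unfolding powr_add using r by (simp add: powr_half_sqrt)
    also have "\<dots> \<le> sqrt e * r powr (-3/2)"
      using r by (intro mult_right_mono) auto
    finally show ?thesis by (simp add: r_def)
  qed (simp add: truncated_kernel_def)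
qed

lemma borel_measurable_cauchy_transform [measurable]:
  assumes "prob_space \<nu>" and [measurable_cong]: "sets \<nu> = sets borel"
  shows "cauchy_transform \<nu> \<in> borel_measurable borel"
proof -
  interpret \<nu>: prob_space \<nu> by fact
  show ?thesis unfolding cauchy_transform_def by measurable
qed

text \<open>\<open>weak_conv_cmeasure\<close> tests with real functions only, so the real and
  imaginary parts are treated separately.\<close>

lemma weak_conv_cmeasure_complex:
  fixes f :: "complex \<Rightarrow> complex"
  assumes conv: "weak_conv_cmeasure \<nu> \<mu>"
    and \<nu>: "\<And>n. prob_space (\<nu> n)" "\<And>n. sets (\<nu> n) = sets borel"
    and \<mu>: "prob_space \<mu>" "sets \<mu> = sets borel"
    and f: "continuous_on UNIV f" "\<And>x. norm (f x) \<le> c"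
  shows "(\<lambda>n. \<integral>x. f x \<partial>\<nu> n) \<longlonglongrightarrow> (\<integral>x. f x \<partial>\<mu>)"
proof -
  have int: "integrable \<kappa> f" if "prob_space \<kappa>" and [measurable_cong]: "sets \<kappa> = sets borel" for \<kappa>
  proof -
    interpret prob_space \<kappa> by fact
    have [measurable]: "f \<in> borel_measurable borel" using f(1) by (rule borel_measurable_continuous_onI)
    show ?thesis by (rule integrable_const_bound[of _ c]) (use f in auto)
  qed
  have "bounded (range (\<lambda>x. Re (f x)))" "bounded (range (\<lambda>x. Im (f x)))"
    using f(2) abs_Re_le_cmod abs_Im_le_cmod unfolding bounded_iff
    by (auto intro!: exI[of _ c] order_trans[OF abs_Re_le_cmod] order_trans[OF abs_Im_le_cmod])
  moreover have "continuous_on UNIV (\<lambda>x. Re (f x))" "continuous_on UNIV (\<lambda>x. Im (f x))"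
    by (intro continuous_intros f)+
  ultimately have "(\<lambda>n. \<integral>x. Re (f x) \<partial>\<nu> n) \<longlonglongrightarrow> (\<integral>x. Re (f x) \<partial>\<mu>)"
    "(\<lambda>n. \<integral>x. Im (f x) \<partial>\<nu> n) \<longlonglongrightarrow> (\<integral>x. Im (f x) \<partial>\<mu>)"
    using conv by (auto simp: weak_conv_cmeasure_def)
  then show ?thesis
    by (simp add: tendsto_complex_iff integral_Re[OF int] integral_Im[OF int] \<nu> \<mu>)
qed

section \<open>L^1 convergence of Cauchy transforms and of the inverse square sums\<close>

context bounded_riesz_potential
begin

text \<open>By Tonelli the integral over z can be taken first. It is at most \<open>M\<close> for
  every xi, and \<nu> has total mass 1.\<close>

lemma nn_integral_nn_integral_riesz_le:
  assumes "prob_space \<nu>" and [measurable_cong]: "sets \<nu> = sets borel"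
  shows "(\<integral>\<^sup>+z. \<integral>\<^sup>+\<xi>. ennreal (norm (z - \<xi>) powr (-3/2)) \<partial>\<nu> \<partial>N) \<le> ennreal M"
proof -
  interpret \<nu>: prob_space \<nu> by fact
  interpret P: pair_sigma_finite N \<nu> ..
  have "(\<integral>\<^sup>+z. \<integral>\<^sup>+\<xi>. ennreal (norm (z - \<xi>) powr (-3/2)) \<partial>\<nu> \<partial>N)
      = (\<integral>\<^sup>+\<xi>. \<integral>\<^sup>+z. ennreal (norm (z - \<xi>) powr (-3/2)) \<partial>N \<partial>\<nu>)"
    by (rule P.Fubini'[symmetric]) measurable
  also have "\<dots> \<le> (\<integral>\<^sup>+\<xi>. ennreal M \<partial>\<nu>)"
    by (intro nn_integral_mono riesz_le)
  also have "\<dots> = ennreal M" by (simp add: \<nu>.emeasure_space_1)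
  finally show ?thesis .
qed

text \<open>The finite double integral makes the Riesz potential of \<nu> finite almost everywhere,
  and 1 / r <= 1 + r^(-3/2) bounds the Cauchy kernel by it.\<close>

lemma AE_integrable_cauchy_kernel:
  assumes "prob_space \<nu>" and [measurable_cong]: "sets \<nu> = sets borel"
  shows "AE z in N. integrable \<nu> (\<lambda>\<xi>. 1 / (z - \<xi>))"
proof -
  interpret \<nu>: prob_space \<nu> by fact
  have "(\<integral>\<^sup>+z. \<integral>\<^sup>+\<xi>. ennreal (norm (z - \<xi>) powr (-3/2)) \<partial>\<nu> \<partial>N) \<noteq> \<infinity>"
    using nn_integral_nn_integral_riesz_le[OF assms] by (auto simp: top_unique)
  then have "AE z in N. (\<integral>\<^sup>+\<xi>. ennreal (norm (z - \<xi>) powr (-3/2)) \<partial>\<nu>) \<noteq> \<infinity>"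
    by (intro nn_integral_PInf_AE) measurable
  then show ?thesis
  proof eventually_elim
    case (elim z)
    show ?case
    proof (rule integrableI_bounded)
      have "(\<integral>\<^sup>+\<xi>. ennreal (norm (1 / (z - \<xi>))) \<partial>\<nu>) \<le> (\<integral>\<^sup>+\<xi>. 1 + ennreal (norm (z - \<xi>) powr (-3/2)) \<partial>\<nu>)"
      proof (rule nn_integral_mono)
        fix \<xi>
        define r where "r = norm (z - \<xi>)"
        have "1 / r \<le> 1 + r powr (-3/2)" if "r > 0"
        proof (cases "r \<ge> 1")
          case True
          then have "1 / r \<le> 1" by simp
          then show ?thesis by (smt (verit) powr_ge_zero)
        next
          case False
          have "1 / r = r powr (-1)" using that by (simp add: powr_minus_divide)
          also have "\<dots> \<le> r powr (-3/2)" using False that by (intro powr_mono') auto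
          finally show ?thesis by simp
        qed
        then have "1 / r \<le> 1 + r powr (-3/2)" by (cases "r = 0") (auto simp: r_def)
        then have "ennreal (1 / r) \<le> ennreal (1 + r powr (-3/2))" by (rule ennreal_leI)
        then show "ennreal (norm (1 / (z - \<xi>))) \<le> 1 + ennreal (norm (z - \<xi>) powr (-3/2))"
          by (simp add: r_def norm_divide ennreal_plus)
      qed
      also have "\<dots> = 1 + (\<integral>\<^sup>+\<xi>. ennreal (norm (z - \<xi>) powr (-3/2)) \<partial>\<nu>)"
        by (subst nn_integral_add) (auto simp: \<nu>.emeasure_space_1)
      also have "\<dots> < \<infinity>" using elim by (simp add: less_top)
      finally show "(\<integral>\<^sup>+\<xi>. ennreal (norm (1 / (z - \<xi>))) \<partial>\<nu>) < \<infinity>" .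
    qed measurable
  qed
qed

text \<open>The pointwise kernel bound is integrated over \<nu> and then over \<open>N\<close>. The
  result does not depend on \<nu>, so one e serves a whole sequence of measures. Integrability of
  the kernel at almost every z allows the two integrals to be subtracted.\<close>

lemma nn_integral_cauchy_transform_truncation_le:
  assumes "prob_space \<nu>" and [measurable_cong]: "sets \<nu> = sets borel" and e: "e > 0"
  shows "(\<integral>\<^sup>+z. ennreal (norm (cauchy_transform \<nu> z - (\<integral>\<xi>. truncated_kernel e (z - \<xi>) \<partial>\<nu>))) \<partial>N)
       \<le> ennreal (sqrt e * M)"
proof -
  interpret \<nu>: prob_space \<nu> by fact
  have [measurable]: "truncated_kernel e \<in> borel_measurable borel"
    by (intro borel_measurable_continuous_onI continuous_truncated_kernel e)
  have "AE z in N. ennreal (norm (cauchy_transform \<nu> z - (\<integral>\<xi>. truncated_kernel e (z - \<xi>) \<partial>\<nu>)))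
      \<le> (\<integral>\<^sup>+\<xi>. ennreal (sqrt e) * ennreal (norm (z - \<xi>) powr (-3/2)) \<partial>\<nu>)"
    using AE_integrable_cauchy_kernel[OF assms(1,2)]
  proof eventually_elim
    case (elim z)
    have k: "integrable \<nu> (\<lambda>\<xi>. truncated_kernel e (z - \<xi>))"
      by (rule \<nu>.integrable_const_bound[of _ "1 / e"]) (auto intro: norm_truncated_kernel_le[OF e])
    have "ennreal (norm (cauchy_transform \<nu> z - (\<integral>\<xi>. truncated_kernel e (z - \<xi>) \<partial>\<nu>)))
        = ennreal (norm (\<integral>\<xi>. 1 / (z - \<xi>) - truncated_kernel e (z - \<xi>) \<partial>\<nu>))"
      unfolding cauchy_transform_def by (subst Bochner_Integration.integral_diff[OF elim k]) simp
    also have "\<dots> \<le> (\<integral>\<^sup>+\<xi>. ennreal (norm (1 / (z - \<xi>) - truncated_kernel e (z - \<xi>))) \<partial>\<nu>)"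
      by (intro integral_norm_bound_ennreal Bochner_Integration.integrable_diff elim k)
    also have "\<dots> \<le> (\<integral>\<^sup>+\<xi>. ennreal (sqrt e) * ennreal (norm (z - \<xi>) powr (-3/2)) \<partial>\<nu>)"
    proof (rule nn_integral_mono)
      fix \<xi>
      show "ennreal (norm (1 / (z - \<xi>) - truncated_kernel e (z - \<xi>)))
          \<le> ennreal (sqrt e) * ennreal (norm (z - \<xi>) powr (-3/2))"
        using ennreal_leI[OF norm_diff_truncated_kernel_le[OF e, of "z - \<xi>"]] e
        by (simp add: ennreal_mult)
    qed
    finally show ?case .
  qed
  then have "(\<integral>\<^sup>+z. ennreal (norm (cauchy_transform \<nu> z - (\<integral>\<xi>. truncated_kernel e (z - \<xi>) \<partial>\<nu>))) \<partial>N)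
      \<le> (\<integral>\<^sup>+z. \<integral>\<^sup>+\<xi>. ennreal (sqrt e) * ennreal (norm (z - \<xi>) powr (-3/2)) \<partial>\<nu> \<partial>N)"
    by (rule nn_integral_mono_AE)
  also have "\<dots> = ennreal (sqrt e) * (\<integral>\<^sup>+z. \<integral>\<^sup>+\<xi>. ennreal (norm (z - \<xi>) powr (-3/2)) \<partial>\<nu> \<partial>N)"
    by (simp add: nn_integral_cmult)
  also have "\<dots> \<le> ennreal (sqrt e) * ennreal M"
    by (intro mult_left_mono nn_integral_nn_integral_riesz_le[OF assms(1,2)]) auto
  also have "\<dots> = ennreal (sqrt e * M)"
    using e M_nonneg by (simp add: ennreal_mult)
  finally show ?thesis .
qed

text \<open>Both truncation errors are small uniformly in n, and for fixed e the truncated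
  transforms converge in L^1 by dominated convergence.\<close>

lemma cauchy_transform_tendsto_L1:
  assumes conv: "weak_conv_cmeasure \<nu> \<mu>"
    and \<nu>: "\<And>n. prob_space (\<nu> n)" and [measurable_cong]: "\<And>n. sets (\<nu> n) = sets borel"
    and \<mu>: "prob_space \<mu>" and [measurable_cong]: "sets \<mu> = sets borel"
  shows "(\<lambda>n. \<integral>\<^sup>+z. ennreal (norm (cauchy_transform (\<nu> n) z - cauchy_transform \<mu> z)) \<partial>N) \<longlonglongrightarrow> 0"
proof (rule tendsto_zero_ennreal)
  fix d :: real assume d: "d > 0"
  have [measurable]: "cauchy_transform (\<nu> n) \<in> borel_measurable borel" for n
    by (rule borel_measurable_cauchy_transform) fact+
  have [measurable]: "cauchy_transform \<mu> \<in> borel_measurable borel"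
    by (rule borel_measurable_cauchy_transform) fact+
  \<comment> \<open>The square makes sqrt e * M at most d / 4. The summand 1 excludes division by
    zero when M = 0.\<close>
  define e where "e = (d / (4 * (M + 1)))\<^sup>2"
  have e: "e > 0" "sqrt e = d / (4 * (M + 1))" using d M_nonneg by (auto simp: e_def)
  have eM: "sqrt e * M \<le> d / 4" unfolding e(2) using d M_nonneg by (simp add: field_simps)
  have [measurable]: "truncated_kernel e \<in> borel_measurable borel"
    by (intro borel_measurable_continuous_onI continuous_truncated_kernel e)
  define P where "P \<kappa> z = (\<integral>\<xi>. truncated_kernel e (z - \<xi>) \<partial>\<kappa>)" for \<kappa> z
  have P_meas: "P \<kappa> \<in> borel_measurable borel"
    if "prob_space \<kappa>" and [measurable_cong]: "sets \<kappa> = sets borel" for \<kappa>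
  proof -
    interpret \<kappa>: prob_space \<kappa> by fact
    show ?thesis unfolding P_def by measurable
  qed
  have [measurable]: "P (\<nu> n) \<in> borel_measurable borel" for n by (rule P_meas) fact+
  have [measurable]: "P \<mu> \<in> borel_measurable borel" by (rule P_meas) fact+
  have P_bound: "norm (P \<kappa> z) \<le> 1 / e"
    if "prob_space \<kappa>" and [measurable_cong]: "sets \<kappa> = sets borel" for \<kappa> z
  proof -
    interpret \<kappa>: prob_space \<kappa> by fact
    have "norm (P \<kappa> z) \<le> (\<integral>\<xi>. 1 / e \<partial>\<kappa>)"
      unfolding P_def
      by (rule Bochner_Integration.integral_norm_bound_integral)
         (auto intro!: \<kappa>.integrable_const_bound[of _ "1 / e"] norm_truncated_kernel_le e)
    then show ?thesis by (simp add: \<kappa>.prob_space)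
  qed
  \<comment> \<open>For fixed z the truncated kernel is a bounded continuous function of xi, so weak
    convergence applies at every z.\<close>
  have P_lim: "(\<lambda>n. P (\<nu> n) z) \<longlonglongrightarrow> P \<mu> z" for z
    unfolding P_def
  proof (rule weak_conv_cmeasure_complex[OF conv])
    show "continuous_on UNIV (\<lambda>\<xi>. truncated_kernel e (z - \<xi>))"
      by (intro continuous_on_compose2[OF continuous_truncated_kernel[OF e(1)]] continuous_intros) auto
  qed (fact | rule norm_truncated_kernel_le[OF e(1)])+
  have "(\<lambda>n. \<integral>\<^sup>+z. ennreal (norm (P (\<nu> n) z - P \<mu> z)) \<partial>N) \<longlonglongrightarrow> (\<integral>\<^sup>+z. 0 \<partial>N)"
  proof (rule nn_integral_dominated_convergence)
    show "AE z in N. ennreal (norm (P (\<nu> n) z - P \<mu> z)) \<le> ennreal (2 / e)" for n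
    proof (intro AE_I2 ennreal_leI)
      fix z
      have "norm (P (\<nu> n) z - P \<mu> z) \<le> norm (P (\<nu> n) z) + norm (P \<mu> z)" by (rule norm_triangle_ineq4)
      also have "\<dots> \<le> 1 / e + 1 / e" by (intro add_mono P_bound) fact+
      finally show "norm (P (\<nu> n) z - P \<mu> z) \<le> 2 / e" by simp
    qed
    show "(\<integral>\<^sup>+z. ennreal (2 / e) \<partial>N) < \<infinity>"
      using emeasure_finite[of "space N"] by (simp add: ennreal_mult_eq_top_iff less_top[symmetric])
    show "AE z in N. (\<lambda>n. ennreal (norm (P (\<nu> n) z - P \<mu> z))) \<longlonglongrightarrow> 0"
    proof (rule AE_I2)
      fix z
      have "(\<lambda>n. norm (P (\<nu> n) z - P \<mu> z)) \<longlonglongrightarrow> 0"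
        using P_lim[of z] by (intro tendsto_norm_zero) (simp add: LIM_zero)
      then show "(\<lambda>n. ennreal (norm (P (\<nu> n) z - P \<mu> z))) \<longlonglongrightarrow> 0"
        using tendsto_ennrealI by fastforce
    qed
  qed measurable
  then have "(\<lambda>n. \<integral>\<^sup>+z. ennreal (norm (P (\<nu> n) z - P \<mu> z)) \<partial>N) \<longlonglongrightarrow> 0" by simp
  then have "\<forall>\<^sub>F n in sequentially. (\<integral>\<^sup>+z. ennreal (norm (P (\<nu> n) z - P \<mu> z)) \<partial>N) < ennreal (d / 4)"
    by (rule order_tendstoD) (use d in simp)
  then show "\<forall>\<^sub>F n in sequentially.
      (\<integral>\<^sup>+z. ennreal (norm (cauchy_transform (\<nu> n) z - cauchy_transform \<mu> z)) \<partial>N) < ennreal d"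
  proof eventually_elim
    case (elim n)
    let ?C = "cauchy_transform"
    have "(\<integral>\<^sup>+z. ennreal (norm (?C (\<nu> n) z - ?C \<mu> z)) \<partial>N)
      \<le> (\<integral>\<^sup>+z. ennreal (norm (?C (\<nu> n) z - P (\<nu> n) z)) + ennreal (norm (?C \<mu> z - P \<mu> z))
            + ennreal (norm (P (\<nu> n) z - P \<mu> z)) \<partial>N)"
    proof (rule nn_integral_mono)
      fix z
      have "norm (?C (\<nu> n) z - ?C \<mu> z)
          \<le> norm (?C (\<nu> n) z - P (\<nu> n) z) + norm (?C \<mu> z - P \<mu> z) + norm (P (\<nu> n) z - P \<mu> z)"
        by norm
      then show "ennreal (norm (?C (\<nu> n) z - ?C \<mu> z)) \<le> ennreal (norm (?C (\<nu> n) z - P (\<nu> n) z))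
         + ennreal (norm (?C \<mu> z - P \<mu> z)) + ennreal (norm (P (\<nu> n) z - P \<mu> z))"
        by (simp add: ennreal_plus[symmetric] ennreal_leI del: ennreal_plus)
    qed
    also have "\<dots> = (\<integral>\<^sup>+z. ennreal (norm (?C (\<nu> n) z - P (\<nu> n) z)) \<partial>N)
        + (\<integral>\<^sup>+z. ennreal (norm (?C \<mu> z - P \<mu> z)) \<partial>N)
        + (\<integral>\<^sup>+z. ennreal (norm (P (\<nu> n) z - P \<mu> z)) \<partial>N)"
      by (simp add: nn_integral_add)
    also have "\<dots> \<le> ennreal (d / 4) + ennreal (d / 4) + ennreal (d / 4)"
    proof (intro add_mono)
      have trunc: "(\<integral>\<^sup>+z. ennreal (norm (?C \<kappa> z - P \<kappa> z)) \<partial>N) \<le> ennreal (d / 4)"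
        if "prob_space \<kappa>" "sets \<kappa> = sets borel" for \<kappa>
        using nn_integral_cauchy_transform_truncation_le[OF that e(1)] ennreal_leI[OF eM]
        unfolding P_def by (rule order_trans)
      show "(\<integral>\<^sup>+z. ennreal (norm (?C (\<nu> n) z - P (\<nu> n) z)) \<partial>N) \<le> ennreal (d / 4)"
        "(\<integral>\<^sup>+z. ennreal (norm (?C \<mu> z - P \<mu> z)) \<partial>N) \<le> ennreal (d / 4)"
        by (rule trunc, fact, fact)+
    qed (use elim in simp)
    also have "\<dots> = ennreal (3 / 4 * d)" using d by (simp add: ennreal_plus[symmetric] del: ennreal_plus)
    also have "\<dots> < ennreal d" using d by (simp add: ennreal_less_iff)
    finally show ?case .
  qed
qed

text \<open>The power 3/4 is subadditive and turns |z - xi|^(-2) into |z - xi|^(-3/2), so each root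
  costs at most \<open>M\<close>, wherever it lies and with multiplicity.\<close>

lemma nn_integral_powr_sum_inverse_square_le:
  fixes A :: "complex multiset"
  shows "(\<integral>\<^sup>+z. ennreal (norm (\<Sum>\<xi>\<in>#A. 1 / (z - \<xi>)\<^sup>2) powr (3/4)) \<partial>N) \<le> ennreal (real (size A) * M)"
proof -
  have pw: "norm (1 / (w::complex)\<^sup>2) powr (3/4) = norm w powr (-3/2)" for w
  proof (cases "w = 0")
    case False
    have "norm (1 / w\<^sup>2) = norm w powr (-2)"
      using False by (simp add: norm_divide norm_power powr_minus_divide powr_numeral)
    then show ?thesis by (simp add: powr_powr)
  qed simp
  have "(\<integral>\<^sup>+z. ennreal (norm (\<Sum>\<xi>\<in>#A. 1 / (z - \<xi>)\<^sup>2) powr (3/4)) \<partial>N)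
      \<le> (\<integral>\<^sup>+z. ennreal (\<Sum>\<xi>\<in>#A. norm (z - \<xi>) powr (-3/2)) \<partial>N)"
    by (intro nn_integral_mono ennreal_leI order_trans[OF norm_sum_mset_powr_le]) (auto simp: pw)
  also have "\<dots> \<le> ennreal (real (size A) * M)"
  proof (induction A)
    case (add x A)
    have nonneg: "0 \<le> (\<Sum>\<xi>\<in>#A. norm (z - \<xi>) powr (-3/2))" for z by (induction A) auto
    have [measurable]: "(\<lambda>z. \<Sum>\<xi>\<in>#A. norm (z - \<xi>) powr (-3/2)) \<in> borel_measurable borel"
      by (induction A) auto
    have "(\<integral>\<^sup>+z. ennreal (\<Sum>\<xi>\<in>#add_mset x A. norm (z - \<xi>) powr (-3/2)) \<partial>N)
       = (\<integral>\<^sup>+z. ennreal (norm (z - x) powr (-3/2)) + ennreal (\<Sum>\<xi>\<in>#A. norm (z - \<xi>) powr (-3/2)) \<partial>N)"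
      by (intro nn_integral_cong)
         (simp only: image_mset_add_mset sum_mset.add_mset ennreal_plus[OF powr_ge_zero nonneg])
    also have "\<dots> = (\<integral>\<^sup>+z. ennreal (norm (z - x) powr (-3/2)) \<partial>N)
        + (\<integral>\<^sup>+z. ennreal (\<Sum>\<xi>\<in>#A. norm (z - \<xi>) powr (-3/2)) \<partial>N)"
      by (rule nn_integral_add) measurable
    also have "\<dots> \<le> ennreal M + ennreal (real (size A) * M)"
      by (intro add_mono add riesz_le)
    also have "\<dots> = ennreal (real (size (add_mset x A)) * M)"
      using M_nonneg by (simp add: ennreal_plus[symmetric] algebra_simps del: ennreal_plus)
    finally show ?case .
  qed simp
  finally show ?thesis .
qed

text \<open>For m = n + 1 roots, the factor m^(-2) becomes m^(-3/2) under the power 3/4, and the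
  previous bound contributes m. The product m^(-1/2) tends to 0.\<close>

lemma averaged_inverse_square_tendsto_L1:
  fixes A :: "nat \<Rightarrow> complex multiset"
  assumes "\<And>n. size (A n) = Suc n"
  shows "(\<lambda>n. \<integral>\<^sup>+z. ennreal (norm ((\<Sum>\<xi>\<in>#A n. 1 / (z - \<xi>)\<^sup>2) / of_nat (Suc n) ^ 2) powr (3/4)) \<partial>N) \<longlonglongrightarrow> 0"
proof (rule tendsto_sandwich[OF _ _ tendsto_const])
  have "(\<lambda>n. real (Suc n) powr (-1/2) * M) \<longlonglongrightarrow> 0 * M"
    by (intro tendsto_mult tendsto_const LIMSEQ_Suc[of "\<lambda>n. real n powr (-1/2)"]
          tendsto_neg_powr[OF _ filterlim_real_sequentially]) simp
  then show "(\<lambda>n. ennreal (real (Suc n) powr (-1/2) * M)) \<longlonglongrightarrow> 0"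
    using tendsto_ennrealI by fastforce
  show "\<forall>\<^sub>F n in sequentially.
    (\<integral>\<^sup>+z. ennreal (norm ((\<Sum>\<xi>\<in>#A n. 1 / (z - \<xi>)\<^sup>2) / of_nat (Suc n) ^ 2) powr (3/4)) \<partial>N)
      \<le> ennreal (real (Suc n) powr (-1/2) * M)"
  proof (rule always_eventually, rule allI)
    fix n
    define m where "m = real (Suc n)"
    have m: "m > 0" by (simp add: m_def)
    have [measurable]: "(\<lambda>z. \<Sum>\<xi>\<in>#B. 1 / (z - \<xi>)\<^sup>2) \<in> borel_measurable borel" for B :: "complex multiset"
      by (induction B) auto
    have "norm ((\<Sum>\<xi>\<in>#A n. 1 / (z - \<xi>)\<^sup>2) / of_nat (Suc n) ^ 2) powr (3/4)
        = m powr (-3/2) * norm (\<Sum>\<xi>\<in>#A n. 1 / (z - \<xi>)\<^sup>2) powr (3/4)" for z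
    proof -
      have "norm ((\<Sum>\<xi>\<in>#A n. 1 / (z - \<xi>)\<^sup>2) / of_nat (Suc n) ^ 2)
          = m powr (-2) * norm (\<Sum>\<xi>\<in>#A n. 1 / (z - \<xi>)\<^sup>2)"
        using m unfolding norm_divide norm_power norm_of_nat m_def[symmetric]
        by (simp add: powr_minus_divide powr_numeral)
      then show ?thesis by (simp add: powr_mult powr_powr)
    qed
    then have "(\<integral>\<^sup>+z. ennreal (norm ((\<Sum>\<xi>\<in>#A n. 1 / (z - \<xi>)\<^sup>2) / of_nat (Suc n) ^ 2) powr (3/4)) \<partial>N)
        = ennreal (m powr (-3/2)) * (\<integral>\<^sup>+z. ennreal (norm (\<Sum>\<xi>\<in>#A n. 1 / (z - \<xi>)\<^sup>2) powr (3/4)) \<partial>N)"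
      by (simp add: ennreal_mult nn_integral_cmult)
    also have "\<dots> \<le> ennreal (m powr (-3/2)) * ennreal (m * M)"
      using nn_integral_powr_sum_inverse_square_le[of "A n"] by (intro mult_left_mono) (auto simp: assms m_def)
    also have "\<dots> = ennreal (m powr (-1/2) * M)"
    proof -
      have "m powr (-3/2) * m = m powr (-1/2)"
        using m powr_add[of m "-3/2" 1] by simp
      then show ?thesis
        using m M_nonneg by (simp add: ennreal_mult[symmetric] mult.assoc[symmetric])
    qed
    finally show "(\<integral>\<^sup>+z. ennreal (norm ((\<Sum>\<xi>\<in>#A n. 1 / (z - \<xi>)\<^sup>2) / of_nat (Suc n) ^ 2) powr (3/4)) \<partial>N)
      \<le> ennreal (real (Suc n) powr (-1/2) * M)" by (simp only: m_def)
  qed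
qed (auto intro: always_eventually)

end

text \<open>By Fatou the pointwise liminf has integral 0, so it vanishes almost everywhere, and some
  subsequence attains it. The subsequence may depend on the point, which suffices for an equation
  that is checked at each point separately.\<close>

lemma AE_tendsto_subseq_of_nn_integral_tendsto_0:
  fixes u :: "nat \<Rightarrow> 'a \<Rightarrow> ennreal"
  assumes [measurable]: "\<And>n. u n \<in> borel_measurable M"
    and lim: "(\<lambda>n. \<integral>\<^sup>+x. u n x \<partial>M) \<longlonglongrightarrow> 0"
  shows "AE x in M. \<exists>r. strict_mono r \<and> (\<lambda>n. u (r n) x) \<longlonglongrightarrow> 0"
proof -
  have "(\<integral>\<^sup>+x. liminf (\<lambda>n. u n x) \<partial>M) \<le> liminf (\<lambda>n. \<integral>\<^sup>+x. u n x \<partial>M)"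
    by (rule nn_integral_liminf) measurable
  also have "\<dots> = 0" by (rule lim_imp_Liminf[OF _ lim]) simp
  finally have "AE x in M. liminf (\<lambda>n. u n x) = 0"
    by (subst nn_integral_0_iff_AE[symmetric]) auto
  then show ?thesis
  proof eventually_elim
    case (elim x)
    obtain r where "strict_mono r" "((\<lambda>n. u n x) \<circ> r) \<longlonglongrightarrow> liminf (\<lambda>n. u n x)"
      using liminf_subseq_lim[of "\<lambda>n. u n x"] by auto
    with elim show ?case by (auto simp: o_def)
  qed
qed

subsection \<open>The limit equation\<close>

text \<open>Away from the roots the differential equation can be divided by p and by m^2. Here p'/p
  = m w and p''/p = m^2 (w^2 - S).\<close>

lemma jacobi_poly_riccati:
  fixes a b z :: complex and m :: nat
  defines "p \<equiv> jacobi_poly m a b"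
  defines "w \<equiv> (\<Sum>\<xi>\<in>#proots p. 1 / (z - \<xi>)) / of_nat m"
    and "S \<equiv> (\<Sum>\<xi>\<in>#proots p. 1 / (z - \<xi>)\<^sup>2) / (of_nat m)\<^sup>2"
  assumes z: "z \<noteq> 1" "z \<noteq> -1" and m: "m \<ge> 1" and nz: "poly p z \<noteq> 0"
  shows "(1 - z\<^sup>2) * (w\<^sup>2 - S) + (b / of_nat m - a / of_nat m - (a / of_nat m + b / of_nat m + 2 / of_nat m) * z) * w
           + (1 + a / of_nat m + b / of_nat m + 1 / of_nat m) = 0"
proof -
  define q where "q = (\<Prod>\<xi>\<in>#proots p. [:-\<xi>, 1:])"
  define s1 s2 where "s1 = (\<Sum>\<xi>\<in>#proots p. 1 / (z - \<xi>))" and "s2 = (\<Sum>\<xi>\<in>#proots p. 1 / (z - \<xi>)\<^sup>2)"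
  define k where "k = (of_nat m :: complex)"
  have k: "k \<noteq> 0" using m by (simp add: k_def)
  \<comment> \<open>The leading coefficient cancels in p'/p and p''/p, so the formulas for the monic
    product \<open>q\<close> carry over.\<close>
  have p: "p = smult (lead_coeff p) q"
    unfolding q_def by (rule complex_poly_decompose_multiset[symmetric])
  have "p \<noteq> 0" using nz by auto
  then have "z \<notin># proots p" using nz by simp
  note D = poly_pderiv_prod_mset_linear[OF this, folded q_def s1_def s2_def]
  have d1: "poly (pderiv p) z = s1 * poly p z"
    by (subst (1 2) p) (simp add: pderiv_smult D)
  have d2: "poly (pderiv (pderiv p)) z = (s1\<^sup>2 - s2) * poly p z"
    by (subst (1 2) p) (simp add: pderiv_smult D)
  have "((1 - z\<^sup>2) * (s1\<^sup>2 - s2) + (b - a - (a + b + 2) * z) * s1 + k * (k + a + b + 1)) * poly p z = 0"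
    using jacobi_poly_ode[OF z, where n = m and a = a and b = b, folded p_def, unfolded d1 d2]
    unfolding k_def by (simp only: distrib_right mult.assoc)
  then have ode: "(1 - z\<^sup>2) * (s1\<^sup>2 - s2) + (b - a - (a + b + 2) * z) * s1 + k * (k + a + b + 1) = 0"
    using nz by simp
  define a' b' i where "a' = a / k" and "b' = b / k" and "i = 1 / k"
  have subst: "s1 = k * w" "s2 = k\<^sup>2 * S" "a = k * a'" "b = k * b'" "k * i = 1"
    using k by (simp_all add: a'_def b'_def i_def w_def S_def s1_def s2_def k_def)
  \<comment> \<open>Multiplying by k^2 clears all denominators: the \<open>i\<close> terms yield the
    constants 2 and 1 of the differential equation through \<open>k * i = 1\<close>.\<close>
  have "k\<^sup>2 * ((1 - z\<^sup>2) * (w\<^sup>2 - S) + (b' - a' - (a' + b' + 2 * i) * z) * w + (1 + a' + b' + i))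
    = (1 - z\<^sup>2) * ((k * w)\<^sup>2 - k\<^sup>2 * S) + (k * b' - k * a' - (k * a' + k * b' + 2 * (k * i)) * z) * (k * w)
      + k * (k + k * a' + k * b' + k * i)"
    by (simp add: power2_eq_square algebra_simps)
  also have "\<dots> = 0"
    using ode by (simp only: subst(5) subst(1-4)[symmetric] mult_1_right)
  finally have "(1 - z\<^sup>2) * (w\<^sup>2 - S) + (b' - a' - (a' + b' + 2 * i) * z) * w + (1 + a' + b' + i) = 0"
    using k by simp
  then show ?thesis
    by (simp add: k_def a'_def b'_def i_def)
qed

lemma AE_lborel_if_AE_disc_measure:
  assumes "\<And>n::nat. AE z in disc_measure (real n). P z"
  shows "AE z in lborel. P z"
proof -
  have "AE z in lborel. z \<in> ball 0 (real n) \<longrightarrow> P z" for n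
    using assms[of n] by (simp add: AE_disc_measure_iff)
  then have "AE z in lborel. \<forall>n. z \<in> ball 0 (real n) \<longrightarrow> P z"
    by (subst AE_all_countable) auto
  then show ?thesis
  proof eventually_elim
    case (elim z)
    obtain n where "norm z < real n" using reals_Archimedean2 by blast
    with elim show ?case by auto
  qed
qed

theorem theorem1:
  fixes \<alpha> \<beta> :: "nat \<Rightarrow> complex" and A B :: complex and \<mu> :: "complex measure"
  assumes deg: "\<And>n. n \<ge> 1 \<Longrightarrow> degree (jacobi_poly n (\<alpha> n) (\<beta> n)) = n"
    and limA: "(\<lambda>n. \<alpha> n / of_nat n) \<longlonglongrightarrow> A"
    and limB: "(\<lambda>n. \<beta> n / of_nat n) \<longlonglongrightarrow> B"
    and nondeg: "1 + A + B \<noteq> 0"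
    and sets_mu: "sets \<mu> = sets borel"
    and prob: "prob_space \<mu>"
    and cpt: "\<exists>K. compact K \<and> emeasure \<mu> (UNIV - K) = 0"
    and conv: "weak_conv_cmeasure (\<lambda>n. root_counting_measure (jacobi_poly n (\<alpha> n) (\<beta> n))) \<mu>"
  shows "AE z in lborel. integrable \<mu> (\<lambda>\<xi>. 1 / (z - \<xi>)) \<and>
           (1 - z^2) * (cauchy_transform \<mu> z)^2 - ((A + B) * z + A - B) * cauchy_transform \<mu> z
             + A + B + 1 = 0"
proof -
  \<comment> \<open>The index is shifted by one because the degree is known only for n >= 1. Every
    \<open>p n\<close> then has a root and no division by zero occurs.\<close>
  define p where "p n = jacobi_poly (Suc n) (\<alpha> (Suc n)) (\<beta> (Suc n))" for n
  define \<nu> where "\<nu> n = root_counting_measure (p n)" for n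
  define S where "S n z = (\<Sum>\<xi>\<in>#proots (p n). 1 / (z - \<xi>)\<^sup>2) / (of_nat (Suc n))\<^sup>2" for n z
  define C where "C = cauchy_transform \<mu>"
  have degp: "degree (p n) = Suc n" for n using deg[of "Suc n"] by (simp add: p_def)
  have pn0: "p n \<noteq> 0" for n using degp[of n] by auto
  have prob_\<nu>: "prob_space (\<nu> n)" for n
    unfolding \<nu>_def by (rule prob_space_root_counting_measure) (simp add: degp)
  have sets_\<nu>: "sets (\<nu> n) = sets borel" for n by (simp add: \<nu>_def root_counting_measure_def)
  have conv': "weak_conv_cmeasure \<nu> \<mu>"
    using conv unfolding weak_conv_cmeasure_def \<nu>_def p_def
    by (auto intro!: LIMSEQ_Suc[of "\<lambda>n. integral\<^sup>L (root_counting_measure (jacobi_poly n (\<alpha> n) (\<beta> n))) f" for f])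
  have C\<nu>: "cauchy_transform (\<nu> n) z = (\<Sum>\<xi>\<in>#proots (p n). 1 / (z - \<xi>)) / of_nat (Suc n)" for n z
    unfolding cauchy_transform_def \<nu>_def
    by (subst integral_root_counting_measure) (auto simp: degp)

  have lims: "(\<lambda>n. \<alpha> (Suc n) / of_nat (Suc n)) \<longlonglongrightarrow> A" "(\<lambda>n. \<beta> (Suc n) / of_nat (Suc n)) \<longlonglongrightarrow> B"
    "(\<lambda>n. 1 / of_nat (Suc n) :: complex) \<longlonglongrightarrow> 0"
    using LIMSEQ_Suc[OF limA] LIMSEQ_Suc[OF limB] LIMSEQ_Suc[OF lim_1_over_n[where 'a = complex]] by simp_all
  \<comment> \<open>Outside this countable, hence null, set the Riccati equation holds for all n at
    once.\<close>
  define bad where "bad = {1, -1} \<union> (\<Union>n. {z. poly (p n) z = 0})"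
  have "countable {z. poly (p n) z = 0}" for n
    by (intro countable_finite poly_roots_finite pn0)
  then have "countable bad" by (simp add: bad_def)
  then have "bad \<in> null_sets lborel" by (rule countable_imp_null_set_lborel)
  then have good: "AE z in lborel. z \<notin> bad" by (rule AE_not_in)

  have limit_equation: "(1 - z^2) * (C z)^2 - ((A + B) * z + A - B) * C z + A + B + 1 = 0"
    if z: "z \<notin> bad" and r: "strict_mono r"
      and C: "(\<lambda>n. cauchy_transform (\<nu> (r n)) z) \<longlonglongrightarrow> C z" and S: "(\<lambda>n. S (r n) z) \<longlonglongrightarrow> 0" for z r
  proof -
    define c d where "c n = \<alpha> (Suc n) / of_nat (Suc n)" and "d n = \<beta> (Suc n) / of_nat (Suc n)" for n
    define i where "i n = (1 / of_nat (Suc n) :: complex)" for n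
    define w where "w n = cauchy_transform (\<nu> n) z" for n
    have "(1 - z\<^sup>2) * ((w n)\<^sup>2 - S n z) + (d n - c n - (c n + d n + 2 * i n) * z) * w n + (1 + c n + d n + i n) = 0" for n
      using jacobi_poly_riccati[of z "Suc n" "\<alpha> (Suc n)" "\<beta> (Suc n)"] z
      by (simp add: bad_def p_def C\<nu> S_def c_def d_def i_def w_def)
    then have "(\<lambda>n. (1 - z\<^sup>2) * ((w (r n))\<^sup>2 - S (r n) z)
        + (d (r n) - c (r n) - (c (r n) + d (r n) + 2 * i (r n)) * z) * w (r n)
        + (1 + c (r n) + d (r n) + i (r n))) \<longlonglongrightarrow> 0" by simp
    moreover have "c \<longlonglongrightarrow> A" "d \<longlonglongrightarrow> B" "i \<longlonglongrightarrow> 0"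
      unfolding c_def d_def i_def by (fact lims)+
    note this[THEN LIMSEQ_subseq_LIMSEQ[OF _ r], unfolded o_def]
    then have "(\<lambda>n. (1 - z\<^sup>2) * ((w (r n))\<^sup>2 - S (r n) z)
        + (d (r n) - c (r n) - (c (r n) + d (r n) + 2 * i (r n)) * z) * w (r n)
        + (1 + c (r n) + d (r n) + i (r n)))
      \<longlonglongrightarrow> (1 - z\<^sup>2) * ((C z)\<^sup>2 - 0) + (B - A - (A + B + 2 * 0) * z) * C z + (1 + A + B + 0)"
      using C S unfolding w_def[symmetric]
      by (intro tendsto_add tendsto_diff tendsto_mult tendsto_power tendsto_const)
    ultimately have "(1 - z\<^sup>2) * ((C z)\<^sup>2 - 0) + (B - A - (A + B + 2 * 0) * z) * C z + (1 + A + B + 0) = 0"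
      using LIMSEQ_unique by blast
    then show ?thesis by (simp add: algebra_simps)
  qed

  show ?thesis
  proof (rule AE_lborel_if_AE_disc_measure)
    fix R :: nat
    obtain M where "bounded_riesz_potential (disc_measure (real R)) M"
      using bounded_riesz_potential_disc_measure by blast
    then interpret bounded_riesz_potential "disc_measure (real R)" M .
    have [measurable]: "C \<in> borel_measurable borel"
      unfolding C_def by (rule borel_measurable_cauchy_transform) fact+
    have [measurable]: "cauchy_transform (\<nu> n) \<in> borel_measurable borel" for n
      by (rule borel_measurable_cauchy_transform) fact+
    have [measurable]: "(\<lambda>z. \<Sum>\<xi>\<in>#Q. 1 / (z - \<xi>)\<^sup>2) \<in> borel_measurable borel" for Q :: "complex multiset"
      by (induction Q) auto
    have [measurable]: "S n \<in> borel_measurable borel" for n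
      unfolding S_def by measurable
    \<comment> \<open>Adding the two nonnegative errors lets one subsequence serve both limits,
      since each summand is bounded by \<open>u\<close>.\<close>
    define u where "u n z = ennreal (norm (cauchy_transform (\<nu> n) z - C z)) + ennreal (norm (S n z) powr (3/4))" for n z
    have u_lim: "(\<lambda>n. \<integral>\<^sup>+z. u n z \<partial>disc_measure (real R)) \<longlonglongrightarrow> 0"
    proof -
      have "(\<lambda>n. (\<integral>\<^sup>+z. ennreal (norm (cauchy_transform (\<nu> n) z - C z)) \<partial>disc_measure (real R))
          + (\<integral>\<^sup>+z. ennreal (norm (S n z) powr (3/4)) \<partial>disc_measure (real R))) \<longlonglongrightarrow> 0 + 0"
        unfolding C_def S_def
        by (intro tendsto_add cauchy_transform_tendsto_L1[OF conv' prob_\<nu> sets_\<nu> prob sets_mu]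
              averaged_inverse_square_tendsto_L1) (simp add: size_proots_complex degp)
      then show ?thesis unfolding u_def by (simp add: nn_integral_add)
    qed
    have "AE z in disc_measure (real R). \<exists>r. strict_mono r \<and> (\<lambda>n. u (r n) z) \<longlonglongrightarrow> 0"
      by (rule AE_tendsto_subseq_of_nn_integral_tendsto_0[OF _ u_lim]) (unfold u_def, measurable)
    moreover have "AE z in disc_measure (real R). z \<notin> bad"
      using good unfolding AE_disc_measure_iff by eventually_elim simp
    moreover note AE_integrable_cauchy_kernel[OF prob sets_mu]
    ultimately show "AE z in disc_measure (real R). integrable \<mu> (\<lambda>\<xi>. 1 / (z - \<xi>)) \<and>
           (1 - z^2) * (cauchy_transform \<mu> z)^2 - ((A + B) * z + A - B) * cauchy_transform \<mu> z
             + A + B + 1 = 0"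
    proof eventually_elim
      case (elim z)
      then obtain r where r: "strict_mono r" and u: "(\<lambda>n. u (r n) z) \<longlonglongrightarrow> 0" by blast
      have "(\<lambda>n. ennreal (norm (cauchy_transform (\<nu> (r n)) z - C z))) \<longlonglongrightarrow> 0"
        by (rule tendsto_sandwich[OF _ _ tendsto_const u]) (auto simp: u_def)
      then have C0: "(\<lambda>n. norm (cauchy_transform (\<nu> (r n)) z - C z)) \<longlonglongrightarrow> 0"
        by (subst (asm) ennreal_tendsto_0_iff) auto
      have "(\<lambda>n. ennreal (norm (S (r n) z) powr (3/4))) \<longlonglongrightarrow> 0"
        by (rule tendsto_sandwich[OF _ _ tendsto_const u]) (auto simp: u_def)
      then have S34: "(\<lambda>n. norm (S (r n) z) powr (3/4)) \<longlonglongrightarrow> 0"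
        by (subst (asm) ennreal_tendsto_0_iff) auto
      from C0 have C: "(\<lambda>n. cauchy_transform (\<nu> (r n)) z) \<longlonglongrightarrow> C z"
        by (rule LIM_zero_cancel[OF tendsto_norm_zero_cancel])
      \<comment> \<open>The exponent 4/3 undoes the power 3/4 and gives convergence of
        \<open>S\<close> itself.\<close>
      have "(\<lambda>n. (norm (S (r n) z) powr (3/4)) powr (4/3)) \<longlonglongrightarrow> 0 powr (4/3)"
        by (rule tendsto_powr'[OF S34 tendsto_const]) auto
      then have "(\<lambda>n. S (r n) z) \<longlonglongrightarrow> 0"
        by (simp add: powr_powr tendsto_norm_zero_iff)
      from limit_equation[OF _ r C this] elim show ?case by (simp add: C_def)
    qed
  qed
qed

end
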